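(* Let $U=(u_0,u_1)$ and $V=(v_0,v_1)$ be open intervals in $\mathbb{R}$, let $k\ge2$, and let $f:U\to\mathbb{R}$ and $g:V\to\mathbb{R}$ be $C^k$. Suppose $\dot x=f(x)$ and $\dot y=g(y)$ have precisely $n\ge1$ stationary points, $x_1<x_2<\cdots<x_n$ in $U$ and $y_1<y_2<\cdots<y_n$ in $V$ respectively, with $f'(x_j)=g'(y_j)\ne0$ for all $j\in\{1,2,\ldots,n\}$. Then there exist $x_0\in[u_0,x_1)$, $y_0\in[v_0,y_1)$, $x_{n+1}\in(x_n,u_1]$ and $y_{n+1}\in(y_n,v_1]$ such that, for all $j\in\{1,2,\ldots,n\}$, $\dot x=f(x)$ on $(x_{j-1},x_{j+1})$ and $\dot y=g(y)$ on $(y_{j-1},y_{j+1})$ are $C^k$-conjugate.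
   Context: For open intervals $I,J\subset\mathbb{R}$ and functions $F:I\to\mathbb{R}$, $G:J\to\mathbb{R}$, the equations $\dot x=F(x)$ on $I$ and $\dot y=G(y)$ on $J$ are called $C^r$-conjugate ($r\ge1$) if there is a $C^r$ diffeomorphism $h:I\to J$ with $G(h(x))=h'(x)F(x)$ for all $x\in I$. A stationary point of $\dot x=F(x)$ is a zero of $F$. The conjugacy may be a different map for each $j$. *)

theory Defs
  imports "HOL-Analysis.Analysis"
begin

text \<open>
  Only meant for open sets \<open>S\<close>: there the iterated derivatives at a point of \<open>S\<close>
  depend only on \<open>f\<close> near that point, so the values of \<open>f\<close> outside \<open>S\<close> are irrelevant.
\<close>
definition C_on :: "nat \<Rightarrow> (real \<Rightarrow> real) \<Rightarrow> real set \<Rightarrow> bool" where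
  "C_on k f S \<longleftrightarrow>
     (\<forall>i<k. \<forall>x\<in>S. (deriv ^^ i) f field_differentiable (at x)) \<and>
     continuous_on S ((deriv ^^ k) f)"

definition C_diffeomorphism :: "nat \<Rightarrow> real set \<Rightarrow> real set \<Rightarrow> (real \<Rightarrow> real) \<Rightarrow> bool" where
  "C_diffeomorphism r I J h \<longleftrightarrow>
     bij_betw h I J \<and> C_on r h I \<and> C_on r (inv_into I h) J"

text \<open>\<open>C_conjugate r I F J G\<close>: the equations $\dot x = F(x)$ on \<open>I\<close> and $\dot y = G(y)$
  on \<open>J\<close> are $C^r$-conjugate; meant for open intervals \<open>I\<close>, \<open>J\<close> and \<open>r \<ge> 1\<close>.\<close>
definition C_conjugate ::
  "nat \<Rightarrow> real set \<Rightarrow> (real \<Rightarrow> real) \<Rightarrow> real set \<Rightarrow> (real \<Rightarrow> real) \<Rightarrow> bool" where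
  "C_conjugate r I F J G \<longleftrightarrow>
     (\<exists>h. C_diffeomorphism r I J h \<and> (\<forall>x\<in>I. G (h x) = deriv h x * F x))"

definition stationary_points :: "(real \<Rightarrow> real) \<Rightarrow> real set \<Rightarrow> real set" where
  "stationary_points F I = {x \<in> I. F x = 0}"

text \<open>Extends the real points \<open>x 1, \<dots>, x n\<close> by possibly infinite endpoints at the indices
  \<open>0\<close> and \<open>n + 1\<close>; values at indices above \<open>n + 1\<close> are immaterial.\<close>
definition with_ends :: "nat \<Rightarrow> ereal \<Rightarrow> ereal \<Rightarrow> (nat \<Rightarrow> real) \<Rightarrow> nat \<Rightarrow> ereal" where
  "with_ends n a b x j = (if j = 0 then a else if j = n + 1 then b else ereal (x j))"

end

theory Submission
  imports Defs
begin

text \<open>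
  Around a zero \<open>p\<close> of \<open>f\<close> with \<open>c = f' p \<noteq> 0\<close> write \<open>f s = (s - p) * q s\<close> and
  \<open>q s = c + (s - p) * w s\<close>, where by Hadamard's lemma \<open>q\<close> is $C^{k-1}$ and \<open>w\<close> is $C^{k-2}$.
  If \<open>\<psi>' = - w / q\<close>, then \<open>\<phi> s = (s - p) * exp (\<psi> s)\<close> satisfies \<open>\<phi>' = c * exp \<psi> / q > 0\<close>; hence
  \<open>\<phi>\<close> is $C^k$ (not just $C^{k-1}$) and \<open>\<phi>' * f = c * \<phi>\<close> on the whole interval between the
  neighbouring zeros. At a neighbouring zero \<open>\<phi>\<close> is unbounded, because the solutions take infinite
  time to get there. So linearizations of \<open>f\<close> and \<open>g\<close> on corresponding intervals have the same
  range, once the two outer intervals are cut at a common level, and the composition of one with the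
  inverse of the other is the conjugacy.
\<close>

section \<open>Calculus of \<open>C_on\<close>\<close>

lemma C_on_0: "C_on 0 f S \<longleftrightarrow> continuous_on S f"
  by (simp add: C_on_def)

lemma C_on_Suc:
  "C_on (Suc k) f S \<longleftrightarrow> (\<forall>x\<in>S. f field_differentiable at x) \<and> C_on k (deriv f) S"
proof -
  have "(\<forall>i<Suc k. \<forall>x\<in>S. (deriv ^^ i) f field_differentiable at x) \<longleftrightarrow>
      (\<forall>x\<in>S. f field_differentiable at x) \<and>
      (\<forall>i<k. \<forall>x\<in>S. (deriv ^^ i) (deriv f) field_differentiable at x)"
    unfolding All_less_Suc2 funpow_Suc_right by auto
  then show ?thesis
    unfolding C_on_def funpow_Suc_right by auto
qed

lemma C_on_SucD:
  assumes "C_on (Suc k) f S"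
  shows "\<And>x. x \<in> S \<Longrightarrow> (f has_real_derivative deriv f x) (at x)" "C_on k (deriv f) S"
  using assms by (auto simp: C_on_Suc DERIV_deriv_iff_field_differentiable)

text \<open>Agreement on an open set is agreement near each of its points, so all iterated
  derivatives agree there too.\<close>

lemma C_on_cong:
  assumes "open S" "\<And>x. x \<in> S \<Longrightarrow> f x = g x"
  shows "C_on k f S \<longleftrightarrow> C_on k g S"
proof -
  have ev: "\<forall>\<^sub>F y in nhds x. f y = g y" if "x \<in> S" for x
    using eventually_nhds_in_open[OF assms(1) that] by eventually_elim (simp add: assms(2))
  have d: "(deriv ^^ i) f x = (deriv ^^ i) g x" if "x \<in> S" for i x
    using ev[OF that] by (rule higher_deriv_cong_ev) simp
  have "(deriv ^^ i) f field_differentiable at x \<longleftrightarrow> (deriv ^^ i) g field_differentiable at x"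
    if x: "x \<in> S" for i x
  proof -
    have "\<forall>\<^sub>F y in nhds x. (deriv ^^ i) f y = (deriv ^^ i) g y"
      using eventually_nhds_in_open[OF assms(1) x] by eventually_elim (simp add: d)
    then show ?thesis
      unfolding field_differentiable_def by (intro iff_exI DERIV_cong_ev) auto
  qed
  then show ?thesis
    unfolding C_on_def using d by (simp cong: continuous_on_cong)
qed

text \<open>Step rule for the inductions on the order: a formula \<open>f'\<close> for the
  derivative on \<open>S\<close> suffices, since \<open>deriv f\<close> coincides with it there and
  \<open>C_on_cong\<close> applies.\<close>

lemma C_on_SucI:
  assumes "open S" "\<And>x. x \<in> S \<Longrightarrow> (f has_real_derivative f' x) (at x)" "C_on k f' S"
  shows "C_on (Suc k) f S"
proof -
  have "C_on k (deriv f) S \<longleftrightarrow> C_on k f' S"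
    using assms by (intro C_on_cong) (auto intro: DERIV_imp_deriv)
  then show ?thesis
    using assms unfolding C_on_Suc field_differentiable_def by blast
qed

lemma C_on_continuous: "C_on k f S \<Longrightarrow> continuous_on S f"
  by (cases k) (auto simp: C_on_0 intro!: continuous_at_imp_continuous_on dest: DERIV_isCont C_on_SucD(1))

lemma C_on_pred: "C_on (Suc k) f S \<Longrightarrow> C_on k f S"
proof (induction k arbitrary: f)
  case 0
  then show ?case by (simp add: C_on_0 C_on_continuous)
next
  case (Suc k)
  then show ?case unfolding C_on_Suc[of _ f] by blast
qed

lemma C_on_mono: "C_on k f S \<Longrightarrow> j \<le> k \<Longrightarrow> C_on j f S"
  by (induction k) (auto simp: le_Suc_eq dest: C_on_pred)

lemma C_on_subset: "C_on k f S \<Longrightarrow> T \<subseteq> S \<Longrightarrow> C_on k f T"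
  unfolding C_on_def by (auto intro: continuous_on_subset)

lemma C_on_const: "open S \<Longrightarrow> C_on k (\<lambda>_. c) S"
  by (induction k arbitrary: c) (auto simp: C_on_0 intro!: C_on_SucI derivative_eq_intros)

lemma C_on_add:
  assumes "open S" "C_on k f S" "C_on k g S"
  shows "C_on k (\<lambda>x. f x + g x) S"
  using assms(2,3)
proof (induction k arbitrary: f g)
  case 0
  then show ?case by (auto simp: C_on_0 intro: continuous_intros)
next
  case (Suc k)
  note f = C_on_SucD[OF Suc.prems(1)] and g = C_on_SucD[OF Suc.prems(2)]
  show ?case
    by (rule C_on_SucI[OF assms(1) _ Suc.IH[OF f(2) g(2)]]) (intro DERIV_add f g)
qed

lemma C_on_mult:
  assumes "open S" "C_on k f S" "C_on k g S"
  shows "C_on k (\<lambda>x. f x * g x) S"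
  using assms(2,3)
proof (induction k arbitrary: f g)
  case 0
  then show ?case by (auto simp: C_on_0 intro: continuous_intros)
next
  case (Suc k)
  note f = C_on_SucD[OF Suc.prems(1)] and g = C_on_SucD[OF Suc.prems(2)]
  have "C_on k (\<lambda>x. deriv f x * g x + deriv g x * f x) S"
    by (intro C_on_add[OF assms(1)] Suc.IH[OF f(2) C_on_pred[OF Suc.prems(2)]]
        Suc.IH[OF g(2) C_on_pred[OF Suc.prems(1)]])
  then show ?case
    by (rule C_on_SucI[OF assms(1), rotated]) (intro DERIV_mult f g)
qed

text \<open>Induction on the order with \<open>f\<close> and \<open>g\<close> generalized: the chain
  rule gives the product of \<open>deriv g\<close> after \<open>f\<close>, covered by the induction
  hypothesis, and \<open>deriv f\<close>.\<close>

lemma C_on_compose: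
  assumes "open S" "C_on k f S" "C_on k g T" "f ` S \<subseteq> T"
  shows "C_on k (\<lambda>x. g (f x)) S"
  using assms(2,3,4)
proof (induction k arbitrary: f g)
  case 0
  then show ?case unfolding C_on_0 by (rule_tac continuous_on_compose2[of T g S f])
next
  case (Suc k)
  note f = C_on_SucD[OF Suc.prems(1)] and g = C_on_SucD[OF Suc.prems(2)]
  have "C_on k (\<lambda>x. deriv g (f x) * deriv f x) S"
    by (rule C_on_mult[OF assms(1) Suc.IH[OF C_on_pred[OF Suc.prems(1)] g(2) Suc.prems(3)] f(2)])
  then show ?case
  proof (rule C_on_SucI[OF assms(1), rotated])
    fix x assume "x \<in> S"
    then show "((\<lambda>x. g (f x)) has_real_derivative deriv g (f x) * deriv f x) (at x)"
      using Suc.prems(3) by (intro DERIV_chain2 f g) auto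
  qed
qed

lemma C_on_exp: "C_on k exp (UNIV :: real set)"
  by (induction k) (auto simp: C_on_0 intro!: continuous_intros C_on_SucI)

lemma C_on_inverse: "C_on k inverse (- {0 :: real})"
proof (induction k)
  case 0
  then show ?case by (auto simp: C_on_0 intro!: continuous_intros)
next
  case (Suc k)
  \<comment> \<open>The derivative of \<open>inverse\<close> is minus its square, so the induction
    hypothesis and \<open>C_on_mult\<close> raise the order by one.\<close>
  have "C_on k (\<lambda>x::real. (- 1) * (inverse x * inverse x)) (- {0})"
    by (intro C_on_mult C_on_const Suc.IH) auto
  then show ?case
    by (rule C_on_SucI[rotated 2]) (auto intro!: derivative_eq_intros simp: power2_eq_square)
qed

lemma C_on_divide:
  assumes "open S" "C_on k f S" "C_on k g S" "\<And>x. x \<in> S \<Longrightarrow> g x \<noteq> 0"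
  shows "C_on k (\<lambda>x. f x / g x) S"
proof -
  have "C_on k (\<lambda>x. f x * inverse (g x)) S"
    using assms by (intro C_on_mult C_on_compose[OF _ _ C_on_inverse]) auto
  then show ?thesis by (simp add: divide_inverse)
qed

section \<open>Smoothness of inverse functions\<close>

text \<open>Bootstrapping: the inverse \<open>g\<close> satisfies \<open>g' = 1 / (f' o g)\<close>,
  so each order of smoothness of \<open>g\<close> yields the next, until that of
  \<open>deriv f\<close> is used up.\<close>

lemma C_diffeomorphism_if_deriv_nonzero:
  assumes S: "open S" and f: "C_on (Suc k) f S" and bij: "bij_betw f S T"
    and nz: "\<And>x. x \<in> S \<Longrightarrow> deriv f x \<noteq> 0"
  shows "C_diffeomorphism (Suc k) S T f"
proof -
  define g where "g = inv_into S f"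
  have inj: "inj_on f S" and T: "T = f ` S"
    using bij by (auto simp: bij_betw_def)
  have gS: "g z \<in> S" and fg: "f (g z) = z" if "z \<in> T" for z
    using that by (auto simp: g_def T inv_into_into f_inv_into_f)
  have gf: "g (f x) = x" if "x \<in> S" for x
    using that inj by (simp add: g_def)
  have cont: "continuous_on S f" using f by (rule C_on_continuous)
  have "open T"
    unfolding T by (rule injective_into_1d_imp_open_map_UNIV[OF S cont inj order_refl])
  have g': "(g has_real_derivative inverse (deriv f (g z))) (at z)" if "z \<in> T" for z
  proof -
    \<comment> \<open>The inverse function rule speaks of the point \<open>f (g z)\<close>, which is
      \<open>z\<close>.\<close>
    have "DERIV g (f (g z)) :> inverse (deriv f (g z))"
      unfolding has_field_derivative_def
      using C_on_SucD(1)[OF f gS[OF that]] nz[OF gS[OF that]]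
      by (intro has_derivative_inverse_strong[OF S gS[OF that] cont gf, rotated])
        (auto simp: has_field_derivative_def fun_eq_iff)
    then show ?thesis by (simp add: fg that)
  qed
  have "C_on j g T" if "j \<le> Suc k" for j
    using that
  proof (induction j)
    case 0
    then show ?case
      by (auto simp: C_on_0 intro!: continuous_at_imp_continuous_on DERIV_isCont g')
  next
    case (Suc j)
    have "C_on j (\<lambda>z. deriv f (g z)) T"
      using Suc C_on_SucD(2)[OF f] gS \<open>open T\<close>
      by (intro C_on_compose[of T j g "deriv f" S]) (auto intro: C_on_mono)
    then have "C_on j (\<lambda>z. inverse (deriv f (g z))) T"
      by (rule C_on_compose[OF \<open>open T\<close> _ C_on_inverse]) (auto simp: nz gS)
    then show ?case
      using C_on_SucI[OF \<open>open T\<close> g'] by blast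
  qed
  then show ?thesis
    using f bij by (simp add: C_diffeomorphism_def g_def)
qed

section \<open>Hadamard's lemma\<close>

text \<open>For \<open>m = 0\<close> and \<open>G\<close> the derivative of \<open>F\<close> this is
  the quotient \<open>(F s - F p) / (s - p)\<close>, extended to \<open>s = p\<close> by
  \<open>F' p\<close>. The weight \<open>t ^ m\<close> is there because each differentiation under
  the integral brings out one more factor \<open>t\<close>.\<close>

definition moment :: "nat \<Rightarrow> (real \<Rightarrow> real) \<Rightarrow> real \<Rightarrow> real \<Rightarrow> real" where
  "moment m G p s = integral {0..1} (\<lambda>t. t ^ m * G (p + t * (s - p)))"

text \<open>Joint continuity is what the theorems on parameter integrals ask for; convexity keeps
  the segment from \<open>p\<close> to \<open>s\<close> inside \<open>S\<close>.\<close>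

lemma continuous_on_moment_integrand:
  fixes p :: real and H :: "real \<Rightarrow> real"
  assumes S: "convex S" "p \<in> S" and H: "continuous_on S H"
  shows "continuous_on (S \<times> cbox 0 1) (\<lambda>(s, t). t ^ m * H (p + t * (s - p)))"
proof -
  have c: "continuous_on (S \<times> cbox 0 1) (\<lambda>z. p + snd z * (fst z - p))"
    by (intro continuous_on_add continuous_on_mult continuous_on_diff continuous_on_const
        continuous_on_fst continuous_on_snd continuous_on_id)
  have seg: "p + snd z * (fst z - p) \<in> S" if "z \<in> S \<times> cbox 0 1" for z
    using convexD_alt[OF S, of "fst z" "snd z"] that by (auto simp: algebra_simps)
  have "continuous_on (S \<times> cbox 0 1) (\<lambda>z. H (p + snd z * (fst z - p)))"
    by (rule continuous_on_compose2[OF H c]) (use seg in blast)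
  then show ?thesis
    unfolding split_beta by (intro continuous_on_mult continuous_on_power continuous_on_snd continuous_on_id)
qed

text \<open>Differentiation under the integral sign turns \<open>moment m G p\<close> into
  \<open>moment (Suc m) (deriv G) p\<close>, so the induction on \<open>k\<close> closes with
  \<open>m\<close> and \<open>G\<close> arbitrary.\<close>

lemma C_on_moment:
  assumes S: "open S" "convex S" "p \<in> S" and G: "C_on k G S"
  shows "C_on k (moment m G p) S"
  using G
proof (induction k arbitrary: m G)
  case (0 m G)
  have "continuous_on (S \<times> cbox 0 1) (\<lambda>(s, t). t ^ m * G (p + t * (s - p)))"
    using 0 S by (intro continuous_on_moment_integrand) (auto simp: C_on_0)
  then have "continuous_on S (\<lambda>s. integral (cbox 0 1) (\<lambda>t. t ^ m * G (p + t * (s - p))))"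
    by (rule integral_continuous_on_param)
  then show ?case by (simp add: C_on_0 moment_def[abs_def])
next
  case (Suc k m G)
  have seg: "p + t * (s - p) \<in> S" if "s \<in> S" "t \<in> {0..1}" for s t
    using convexD_alt[OF S(2,3) that(1), of t] that(2) by (simp add: algebra_simps)
  note G = C_on_SucD[OF Suc.prems]
  have cG: "continuous_on S G" "continuous_on S (deriv G)"
    using Suc.prems G(2) by (auto intro: C_on_continuous)
  have "(moment m G p has_real_derivative moment (Suc m) (deriv G) p s) (at s)" if s: "s \<in> S" for s
  proof -
    have "((\<lambda>s. integral (cbox 0 1) (\<lambda>t. t ^ m * G (p + t * (s - p)))) has_real_derivative
        integral (cbox 0 1) (\<lambda>t. t ^ Suc m * deriv G (p + t * (s - p)))) (at s within S)"
    proof (rule leibniz_rule_field_derivative[OF _ _ _ s S(2)])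
      show "((\<lambda>s. t ^ m * G (p + t * (s - p))) has_real_derivative
          t ^ Suc m * deriv G (p + t * (s - p))) (at s within S)"
        if "s \<in> S" "t \<in> cbox 0 1" for s t
      proof -
        have "((\<lambda>s. p + t * (s - p)) has_real_derivative t) (at s within S)"
          by (auto intro!: derivative_eq_intros)
        from DERIV_cmult[OF DERIV_chain2[OF G(1) this], of "t ^ m"]
        show ?thesis using that seg[of s t] by (simp add: mult_ac)
      qed
      show "(\<lambda>t. t ^ m * G (p + t * (s - p))) integrable_on cbox 0 1" if "s \<in> S" for s
      proof (rule integrable_continuous)
        \<comment> \<open>For fixed \<open>s\<close> this is the jointly continuous integrand
          composed with \<open>Pair s\<close>.\<close>
        show "continuous_on (cbox 0 1) (\<lambda>t. t ^ m * G (p + t * (s - p)))"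
          using continuous_on_compose2[OF continuous_on_moment_integrand[OF S(2,3) cG(1), of m],
              of "cbox 0 1" "Pair s"] that
            continuous_on_Pair[OF continuous_on_const continuous_on_id, of "cbox 0 (1::real)" s]
          by (auto simp: split_beta)
      qed
      show "continuous_on (S \<times> cbox 0 1) (\<lambda>(s, t). t ^ Suc m * deriv G (p + t * (s - p)))"
        by (rule continuous_on_moment_integrand[OF S(2,3) cG(2)])
    qed
    then show ?thesis
      unfolding moment_def[abs_def] at_within_open[OF s S(1)] cbox_interval .
  qed
  then show ?case
    by (rule C_on_SucI[OF S(1) _ Suc.IH[OF G(2)]])
qed

text \<open>The integrand times \<open>s - p\<close> is the derivative of \<open>G\<close> along the
  segment from \<open>p\<close> to \<open>s\<close>, so this is the fundamental theorem of calculus.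
  In product form it covers \<open>s = p\<close> as well.\<close>

lemma moment_0_deriv:
  assumes S: "convex S" "p \<in> S" "s \<in> S"
    and G: "C_on (Suc k) G S"
  shows "(s - p) * moment 0 (deriv G) p s = G s - G p"
proof -
  have seg: "p + t * (s - p) \<in> S" if "t \<in> {0..1}" for t
    using convexD_alt[OF S, of t] that by (simp add: algebra_simps)
  have "((\<lambda>t. deriv G (p + t * (s - p)) * (s - p)) has_integral
      G (p + 1 * (s - p)) - G (p + 0 * (s - p))) {0..1}"
  proof (rule fundamental_theorem_of_calculus)
    fix t :: real assume t: "t \<in> {0..1}"
    have "((\<lambda>t. p + t * (s - p)) has_real_derivative s - p) (at t within {0..1})"
      by (auto intro!: derivative_eq_intros)
    from DERIV_chain2[OF C_on_SucD(1)[OF G seg[OF t]] this]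
    show "((\<lambda>t. G (p + t * (s - p))) has_vector_derivative
        deriv G (p + t * (s - p)) * (s - p)) (at t within {0..1})"
      by (simp add: has_real_derivative_iff_has_vector_derivative)
  qed simp
  from integral_unique[OF this] show ?thesis
    by (simp add: moment_def mult.commute[of "s - p"])
qed

lemma convex_einterval: "convex (einterval a b)"
proof -
  have "is_interval (einterval a b)"
    unfolding is_interval_1 einterval_def
    by (auto intro: less_le_trans) (meson ereal_less_eq(3) le_less_trans)
  then show ?thesis by (rule is_interval_convex)
qed

section \<open>Linearization of a hyperbolic zero\<close>

text \<open>Two Hadamard quotients cost two orders of differentiability and integrating
  \<open>r\<close> wins back one; the other returns because the derivative of \<open>\<phi>\<close>
  involves only \<open>c\<close>, \<open>\<psi>\<close> and \<open>q\<close>, but not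
  \<open>w\<close>.\<close>

lemma linearization:
  assumes f: "C_on (Suc (Suc k)) f (einterval a b)" and p: "p \<in> einterval a b"
    and zeros: "\<And>s. s \<in> einterval a b \<Longrightarrow> f s = 0 \<longleftrightarrow> s = p"
    and c: "deriv f p = c" "c \<noteq> 0"
  obtains \<phi> where "C_on (Suc (Suc k)) \<phi> (einterval a b)" "\<phi> p = 0"
    "\<And>s. s \<in> einterval a b \<Longrightarrow> deriv \<phi> s > 0 \<and> deriv \<phi> s * f s = c * \<phi> s"
proof -
  define S where "S = einterval a b"
  have S: "open S" "convex S" "p \<in> S"
    using p by (simp_all add: S_def convex_einterval)
  have f: "C_on (Suc (Suc k)) f S" using f by (simp add: S_def)
  define q where "q = moment 0 (deriv f) p"
  define w where "w = moment 0 (deriv q) p"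
  have Cq: "C_on (Suc k) q S"
    unfolding q_def using S C_on_SucD(2)[OF f] by (rule C_on_moment)
  have Cw: "C_on k w S"
    unfolding w_def using S C_on_SucD(2)[OF Cq] by (rule C_on_moment)
  have "f p = 0" using zeros p by blast
  then have fq: "f s = (s - p) * q s" if "s \<in> S" for s
    using moment_0_deriv[OF S(2,3) that f] by (simp add: q_def)
  \<comment> \<open>At \<open>s = p\<close> the integrand is the constant
    \<open>deriv f p\<close>.\<close>
  have "q p = c" using c by (simp add: q_def moment_def)
  then have qw: "q s = c + (s - p) * w s" if "s \<in> S" for s
    using moment_0_deriv[OF S(2,3) that Cq] by (simp add: w_def)
  have q0: "q s \<noteq> 0" if "s \<in> S" for s
    using fq[OF that] zeros[of s] that \<open>q p = c\<close> c by (cases "s = p") (auto simp: S_def)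
  have contq: "continuous_on S q" using Cq by (rule C_on_continuous)
  \<comment> \<open>\<open>q\<close> has no zero on the connected set \<open>S\<close> and equals
    \<open>c\<close> at \<open>p\<close>, so it has the sign of \<open>c\<close> throughout.\<close>
  have cq: "c / q s > 0" if s: "s \<in> S" for s
  proof -
    have "connected (q ` S)"
      using contq convex_connected[OF S(2)] by (rule connected_continuous_image)
    then have ivl: "\<And>u v z. u \<in> q ` S \<Longrightarrow> v \<in> q ` S \<Longrightarrow> u \<le> z \<Longrightarrow> z \<le> v \<Longrightarrow> z \<in> q ` S"
      by (auto simp: is_interval_connected_1[symmetric] is_interval_1)
    have "c \<in> q ` S" "q s \<in> q ` S" "0 \<notin> q ` S"
      using s S(3) \<open>q p = c\<close> q0 by auto
    then have "(0 < c \<and> 0 < q s) \<or> (c < 0 \<and> q s < 0)"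
      using ivl[of c "q s" 0] ivl[of "q s" c 0] c(2) q0[OF s] by argo
    then show ?thesis by (auto simp: zero_less_divide_iff)
  qed
  \<comment> \<open>This choice makes the numerator of the derivative of \<open>\<phi>\<close> equal
    to \<open>q s - (s - p) * w s\<close>, which is \<open>c\<close> by \<open>qw\<close>. The
    factor \<open>- 1\<close> is written out for \<open>C_on_mult\<close> and
    \<open>C_on_const\<close>.\<close>
  define r where "r = (\<lambda>s. (- 1) * w s / q s)"
  have Cr: "C_on k r S"
    unfolding r_def using S Cw Cq q0
    by (intro C_on_divide C_on_mult C_on_const) (auto intro: C_on_pred)
  have "isCont r s" if "a < s" "s < b" for s :: real
    using C_on_continuous[OF Cr] S(1) that
    by (auto simp: continuous_on_eq_continuous_at S_def einterval_def)
  moreover have "a < b" using p by (auto simp: einterval_def)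
  ultimately obtain \<psi> where "\<And>s. a < ereal s \<Longrightarrow> ereal s < b \<Longrightarrow> (\<psi> has_vector_derivative r s) (at s)"
    using einterval_antiderivative[of a b r] by blast
  then have \<psi>: "(\<psi> has_real_derivative r s) (at s)" if "s \<in> S" for s
    using that by (simp add: has_real_derivative_iff_has_vector_derivative S_def einterval_def)
  have C\<psi>: "C_on (Suc k) \<psi> S"
    by (rule C_on_SucI[OF S(1) \<psi> Cr])
  define \<phi> where "\<phi> = (\<lambda>s. (s - p) * exp (\<psi> s))"
  have \<phi>: "(\<phi> has_real_derivative c * exp (\<psi> s) / q s) (at s)" if "s \<in> S" for s
  proof -
    have "(\<phi> has_real_derivative 1 * exp (\<psi> s) + exp (\<psi> s) * r s * (s - p)) (at s)"
      unfolding \<phi>_def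
      by (intro DERIV_mult DERIV_chain2[OF DERIV_exp] \<psi> that)
        (auto intro!: derivative_eq_intros)
    moreover have "1 * exp (\<psi> s) + exp (\<psi> s) * r s * (s - p) = c * exp (\<psi> s) / q s"
    proof -
      have "1 * exp (\<psi> s) + exp (\<psi> s) * r s * (s - p) = (q s - (s - p) * w s) * exp (\<psi> s) / q s"
        using q0[OF that] by (simp add: r_def field_simps)
      then show ?thesis using qw[OF that] by simp
    qed
    ultimately show ?thesis by simp
  qed
  have "C_on (Suc k) (\<lambda>s. c * exp (\<psi> s) / q s) S"
    using S(1) C\<psi> Cq q0
    by (intro C_on_divide C_on_mult C_on_const C_on_compose[OF _ _ C_on_exp]) auto
  then have "C_on (Suc (Suc k)) \<phi> S"
    using C_on_SucI[OF S(1) \<phi>] by blast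
  moreover have "\<phi> p = 0" by (simp add: \<phi>_def)
  moreover have "deriv \<phi> s > 0 \<and> deriv \<phi> s * f s = c * \<phi> s" if "s \<in> S" for s
  proof -
    have "deriv \<phi> s = c / q s * exp (\<psi> s)"
      using DERIV_imp_deriv[OF \<phi>[OF that]] by simp
    then show ?thesis
      using mult_pos_pos[OF cq[OF that] exp_gt_zero[of "\<psi> s"]] q0[OF that]
      by (simp add: fq[OF that] \<phi>_def)
  qed
  ultimately show ?thesis
    using that unfolding S_def by blast
qed

text \<open>Near \<open>b\<close> we have \<open>|f s| \<le> K * (b - s)\<close>, so for \<open>m * |c| \<ge> K\<close> the function
  \<open>(b - s) * \<phi> s ^ m\<close> is nondecreasing there.\<close>

lemma linearization_unbounded_above:
  fixes \<phi> \<phi>' f :: "real \<Rightarrow> real"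
  assumes pb: "p < b" and c: "c \<noteq> 0" and b: "f b = 0" "f field_differentiable at b"
    and \<phi>: "\<And>s. p < s \<Longrightarrow> s < b \<Longrightarrow> (\<phi> has_real_derivative \<phi>' s) (at s)"
    and pos: "\<And>s. p < s \<Longrightarrow> s < b \<Longrightarrow> \<phi> s > 0 \<and> \<phi>' s > 0"
    and eq: "\<And>s. p < s \<Longrightarrow> s < b \<Longrightarrow> \<phi>' s * f s = c * \<phi> s"
  shows "\<exists>s. p < s \<and> s < b \<and> M < \<phi> s"
proof (rule ccontr)
  assume "\<not> ?thesis"
  then have M: "\<phi> s \<le> M" if "p < s" "s < b" for s using that by force
  obtain D where D: "(f has_real_derivative D) (at b)"
    using b(2) by (auto simp: field_differentiable_def)
  then have "((\<lambda>s. (f s - f b) / (s - b)) \<longlongrightarrow> D) (at b)"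
    by (simp add: has_field_derivative_iff)
  then obtain d where d: "d > 0"
    "\<And>s. s \<noteq> b \<Longrightarrow> \<bar>s - b\<bar> < d \<Longrightarrow> \<bar>(f s - f b) / (s - b) - D\<bar> < 1"
    unfolding LIM_eq by (metis zero_less_one real_norm_def)
  \<comment> \<open>Within distance \<open>d\<close> of \<open>b\<close> the difference quotients of
    \<open>f\<close> differ from \<open>D\<close> by less than 1, so \<open>K\<close> bounds
    them.\<close>
  define K where "K = \<bar>D\<bar> + 1"
  \<comment> \<open>Strictly between \<open>p\<close> and \<open>b\<close>, and at most
    \<open>d / 2\<close> away from \<open>b\<close>, so that the linear bound on \<open>f\<close>
    holds from \<open>e\<close> up to \<open>b\<close>.\<close>
  define e where "e = max ((p + b) / 2) (b - d / 2)"
  have e: "p < e" "e < b" using pb d(1) by (auto simp: e_def less_max_iff_disj)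
  have K: "\<bar>f s\<bar> \<le> K * (b - s)" if "e \<le> s" "s < b" for s
  proof -
    have "\<bar>f s / (s - b) - D\<bar> < 1"
      using d(2)[of s] d(1) that b(1) by (simp add: e_def)
    then have "\<bar>f s / (s - b)\<bar> \<le> K" unfolding K_def by linarith
    then show ?thesis using that by (simp add: abs_divide field_simps)
  qed
  obtain m :: nat where m: "K / \<bar>c\<bar> \<le> real m" using real_arch_simple by blast
  have "K > 0" by (simp add: K_def add_nonneg_pos)
  then have "m \<noteq> 0" using m c by (auto intro!: Nat.gr0I simp: field_simps)
  have mK: "K \<le> real m * \<bar>c\<bar>" using m c by (simp add: field_simps)
  define P where "P = (\<lambda>s. (b - s) * \<phi> s ^ m)"
  have incr: "P e \<le> P t" if t: "e \<le> t" "t < b" for t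
  proof (rule DERIV_nonneg_imp_nondecreasing[OF t(1)])
    fix s assume "e \<le> s" "s \<le> t"
    then have s: "e \<le> s" "p < s" "s < b" using e t by auto
    let ?D = "(- 1) * \<phi> s ^ m + real m * (\<phi>' s * \<phi> s ^ (m - 1)) * (b - s)"
    have "(P has_real_derivative ?D) (at s)"
      unfolding P_def using s
      by (intro DERIV_mult) (auto intro!: derivative_eq_intros \<phi>)
    moreover have "?D \<ge> 0"
    proof -
      \<comment> \<open>Absolute values are taken in \<open>eq\<close> since the signs of
        \<open>c\<close> and \<open>f s\<close> are not fixed here; the factor \<open>|c|\<close>
        cancels at the end.\<close>
      have "\<bar>c\<bar> * \<phi> s = \<phi>' s * \<bar>f s\<bar>"
        using arg_cong[OF eq[OF s(2,3)], of abs] pos[OF s(2,3)] by (simp add: abs_mult)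
      also have "\<dots> \<le> \<phi>' s * (K * (b - s))"
        using K[OF s(1,3)] pos[OF s(2,3)] by (intro mult_left_mono) auto
      also have "\<dots> \<le> \<phi>' s * (real m * \<bar>c\<bar> * (b - s))"
        using mK pos[OF s(2,3)] s by (intro mult_left_mono mult_right_mono) auto
      finally have "\<bar>c\<bar> * \<phi> s \<le> \<bar>c\<bar> * (real m * \<phi>' s * (b - s))"
        by (simp add: mult_ac)
      then have "\<phi> s \<le> real m * \<phi>' s * (b - s)"
        using c by (simp add: mult_le_cancel_left)
      then have "\<phi> s * \<phi> s ^ (m - 1) \<le> real m * \<phi>' s * (b - s) * \<phi> s ^ (m - 1)"
        using pos[OF s(2,3)] by (intro mult_right_mono) auto
      moreover have "\<phi> s * \<phi> s ^ (m - 1) = \<phi> s ^ m"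
        using \<open>m \<noteq> 0\<close> by (cases m) auto
      ultimately show ?thesis by (simp add: mult_ac)
    qed
    ultimately show "\<exists>y. (P has_real_derivative y) (at s) \<and> 0 \<le> y" by blast
  qed
  have "M > 0" using M[OF e] pos[OF e] by linarith
  have "P e > 0" using e pos[OF e] by (simp add: P_def)
  \<comment> \<open>So close to \<open>b\<close> that \<open>(b - t) * M ^ m\<close> is at most
    \<open>P e / 2\<close>, which contradicts \<open>P e \<le> P t\<close> and
    \<open>\<phi> t \<le> M\<close>.\<close>
  define t where "t = max e (b - P e / (2 * M ^ m))"
  have t: "e \<le> t" "t < b" "p < t"
    using \<open>P e > 0\<close> \<open>M > 0\<close> e by (auto simp: t_def)
  have "P e \<le> (b - t) * \<phi> t ^ m" using incr[OF t(1,2)] by (simp add: P_def)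
  also have "\<dots> \<le> (b - t) * M ^ m"
    using M[OF t(3,2)] pos[OF t(3,2)] t by (intro mult_left_mono power_mono) auto
  also have "\<dots> \<le> P e / (2 * M ^ m) * M ^ m"
    using \<open>M > 0\<close> by (intro mult_right_mono) (auto simp: t_def)
  also have "\<dots> < P e" using \<open>P e > 0\<close> \<open>M > 0\<close> by simp
  finally show False by simp
qed

text \<open>Reflection at the origin: \<open>- \<phi> (- s)\<close> linearizes
  \<open>- f (- s)\<close> with the same \<open>c\<close>, and the left end becomes a right
  end.\<close>

lemma linearization_unbounded_below:
  fixes \<phi> \<phi>' f :: "real \<Rightarrow> real"
  assumes pa: "a < p" and c: "c \<noteq> 0" and a: "f a = 0" "f field_differentiable at a"
    and \<phi>: "\<And>s. a < s \<Longrightarrow> s < p \<Longrightarrow> (\<phi> has_real_derivative \<phi>' s) (at s)"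
    and pos: "\<And>s. a < s \<Longrightarrow> s < p \<Longrightarrow> \<phi> s < 0 \<and> \<phi>' s > 0"
    and eq: "\<And>s. a < s \<Longrightarrow> s < p \<Longrightarrow> \<phi>' s * f s = c * \<phi> s"
  shows "\<exists>s. a < s \<and> s < p \<and> \<phi> s < M"
proof -
  have "\<exists>s. - p < s \<and> s < - a \<and> - M < - \<phi> (- s)"
  proof (rule linearization_unbounded_above[where f = "\<lambda>s. - f (- s)" and \<phi>' = "\<lambda>s. \<phi>' (- s)"])
    show "- p < - a" "c \<noteq> 0" "- f (- (- a)) = 0" using assms by auto
    obtain D where "(f has_real_derivative D) (at a)"
      using a(2) by (auto simp: field_differentiable_def)
    then have "((\<lambda>s. f (- s)) has_real_derivative - D) (at (- a))"
      using DERIV_mirror[of "\<lambda>s. f (- s)" "- D" a] by simp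
    then show "(\<lambda>s. - f (- s)) field_differentiable at (- a)"
      by (intro field_differentiable_minus) (auto simp: field_differentiable_def)
    fix s assume s: "- p < s" "s < - a"
    then have s': "a < - s" "- s < p" by auto
    show "((\<lambda>s. - \<phi> (- s)) has_real_derivative \<phi>' (- s)) (at s)"
      using DERIV_minus[OF DERIV_chain2[OF \<phi>[OF s'] DERIV_minus[OF DERIV_ident]]] by simp
    show "- \<phi> (- s) > 0 \<and> \<phi>' (- s) > 0" using pos[OF s'] by simp
    show "\<phi>' (- s) * - f (- s) = c * - \<phi> (- s)" using eq[OF s'] by simp
  qed
  then obtain s where "- p < s" "s < - a" "- M < - \<phi> (- s)" by blast
  then show ?thesis by (intro exI[of _ "- s"]) auto
qed

section \<open>Conjugacy through linearizations\<close>

text \<open>The conjugacy \<open>h\<close> is the inverse of \<open>\<psi>\<close> after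
  \<open>\<phi>\<close>, bijective because both have range \<open>W\<close>. Differentiating
  \<open>\<psi> (h s) = \<phi> s\<close> shows that \<open>deriv \<psi> (h s) * g (h s)\<close> and
  \<open>deriv \<psi> (h s) * deriv h s * f s\<close> both equal \<open>c * \<phi> s\<close>; the
  positive factor cancels.\<close>

lemma C_conjugate_if_linearizations:
  assumes I: "open I" and J: "open J"
    and \<phi>: "C_on (Suc k) \<phi> I" "bij_betw \<phi> I W"
      "\<And>s. s \<in> I \<Longrightarrow> deriv \<phi> s > 0 \<and> deriv \<phi> s * f s = c * \<phi> s"
    and \<psi>: "C_on (Suc k) \<psi> J" "bij_betw \<psi> J W"
      "\<And>s. s \<in> J \<Longrightarrow> deriv \<psi> s > 0 \<and> deriv \<psi> s * g s = c * \<psi> s"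
  shows "C_conjugate (Suc k) I f J g"
proof -
  define h where "h = (\<lambda>s. inv_into J \<psi> (\<phi> s))"
  have "C_diffeomorphism (Suc k) J W \<psi>"
    using \<psi> J by (intro C_diffeomorphism_if_deriv_nonzero) force+
  then have "C_on (Suc k) (inv_into J \<psi>) W"
    by (simp add: C_diffeomorphism_def)
  moreover have "\<phi> ` I \<subseteq> W" using \<phi>(2) by (simp add: bij_betw_def)
  ultimately have Ch: "C_on (Suc k) h I"
    unfolding h_def by (rule C_on_compose[OF I \<phi>(1)])
  have bij: "bij_betw h I J"
    using bij_betw_trans[OF \<phi>(2) bij_betw_inv_into[OF \<psi>(2)]] by (simp add: h_def[abs_def] o_def)
  have hJ: "h s \<in> J" if "s \<in> I" for s using bij that by (auto simp: bij_betw_def)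
  have \<psi>h: "\<psi> (h s) = \<phi> s" if "s \<in> I" for s
    using \<phi>(2) \<psi>(2) that unfolding h_def bij_betw_def by (auto intro: f_inv_into_f)
  have deriv_eq: "deriv \<psi> (h s) * deriv h s = deriv \<phi> s" if s: "s \<in> I" for s
  proof -
    have "((\<lambda>s. \<psi> (h s)) has_real_derivative deriv \<psi> (h s) * deriv h s) (at s)"
      by (intro DERIV_chain2 C_on_SucD(1)[OF \<psi>(1)] C_on_SucD(1)[OF Ch] hJ s)
    then have "(\<phi> has_real_derivative deriv \<psi> (h s) * deriv h s) (at s)"
      by (rule has_field_derivative_transform_within_open[OF _ I s \<psi>h])
    then show ?thesis by (simp add: DERIV_imp_deriv)
  qed
  have "C_diffeomorphism (Suc k) I J h"
    using Ch bij I deriv_eq \<phi>(3) by (intro C_diffeomorphism_if_deriv_nonzero) force+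
  moreover have "g (h s) = deriv h s * f s" if s: "s \<in> I" for s
  proof -
    have "deriv \<psi> (h s) * g (h s) = deriv \<psi> (h s) * (deriv h s * f s)"
      using \<psi>(3)[OF hJ[OF s]] \<phi>(3)[OF s] deriv_eq[OF s] \<psi>h[OF s]
      by (simp add: mult.assoc[symmetric])
    then show ?thesis using \<psi>(3)[OF hJ[OF s]] by auto
  qed
  ultimately show ?thesis unfolding C_conjugate_def by blast
qed

section \<open>Linearizations on the basins and their ranges\<close>

text \<open>Connectedness of the image; \<open>s\<close> and \<open>t\<close> may come in either
  order.\<close>

lemma image_einterval_intermediate:
  fixes \<phi> :: "real \<Rightarrow> real"
  assumes "continuous_on (einterval a b) \<phi>" "s \<in> einterval a b" "t \<in> einterval a b"
    and "\<phi> s \<le> z" "z \<le> \<phi> t"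
  shows "z \<in> \<phi> ` einterval a b"
proof -
  have "connected (\<phi> ` einterval a b)"
    using assms(1) convex_connected[OF convex_einterval] by (rule connected_continuous_image)
  then show ?thesis
    using assms(2-) by (auto simp: is_interval_connected_1[symmetric] is_interval_1)
qed

text \<open>Cutting the two outer basins at the levels \<open>-\<epsilon>\<close> and \<open>\<epsilon>\<close> makes the image of each
  linearization independent of the equation.\<close>

definition normal_range :: "nat \<Rightarrow> real \<Rightarrow> nat \<Rightarrow> real set" where
  "normal_range n \<epsilon> j = {z. (j = 1 \<longrightarrow> - \<epsilon> < z) \<and> (j = n \<longrightarrow> z < \<epsilon>)}"

text \<open>Used for \<open>j \<ge> 1\<close> only, where \<open>j - 1\<close> is not truncated. As
  an abbreviation it matches the intervals of the final statement once the \<open>let\<close> is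
  unfolded.\<close>

abbreviation basin :: "nat \<Rightarrow> ereal \<Rightarrow> ereal \<Rightarrow> (nat \<Rightarrow> real) \<Rightarrow> nat \<Rightarrow> real set" where
  "basin n a b x j \<equiv> einterval (with_ends n a b x (j - 1)) (with_ends n a b x (j + 1))"

text \<open>\<open>\<Phi>\<close> and \<open>\<delta>\<close> are chosen before
  \<open>\<epsilon>\<close>, so that two equations can be cut at the same level. At an inner end of
  a basin lies a zero of \<open>f\<close>, where \<open>\<Phi> j\<close> is unbounded; only the
  outer ends are cut.\<close>

lemma basin_linearizations:
  fixes f :: "real \<Rightarrow> real" and x :: "nat \<Rightarrow> real"
  assumes f: "C_on (Suc (Suc k)) f (einterval u0 u1)"
    and n: "n \<ge> 1" and x: "strict_mono_on {1..n} x"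
    and stat: "stationary_points f (einterval u0 u1) = x ` {1..n}"
    and hyp: "\<And>j. j \<in> {1..n} \<Longrightarrow> deriv f (x j) \<noteq> 0"
  obtains \<Phi> \<delta> where "\<delta> > 0"
    "\<And>\<epsilon>. 0 < \<epsilon> \<Longrightarrow> \<epsilon> \<le> \<delta> \<Longrightarrow>
       \<exists>x0\<in>{u0..<ereal (x 1)}. \<exists>xn1\<in>{ereal (x n)<..u1}. \<forall>j\<in>{1..n}.
         C_on (Suc (Suc k)) (\<Phi> j) (basin n x0 xn1 x j) \<and>
         bij_betw (\<Phi> j) (basin n x0 xn1 x j) (normal_range n \<epsilon> j) \<and>
         (\<forall>s\<in>basin n x0 xn1 x j. deriv (\<Phi> j) s > 0 \<and> deriv (\<Phi> j) s * f s = deriv f (x j) * \<Phi> j s)"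
proof -
  \<comment> \<open>The ends are still \<open>u0\<close> and \<open>u1\<close>: each zero is first
    linearized on the whole interval between its neighbours.\<close>
  define X where "X = with_ends n u0 u1 x"
  define I where "I = (\<lambda>j. einterval (X (j - 1)) (X (j + 1)))"
  have X_left: "X (j - 1) = (if j = 1 then u0 else ereal (x (j - 1)))"
    and X_right: "X (j + 1) = (if j = n then u1 else ereal (x (j + 1)))" if "j \<in> {1..n}" for j
    using that by (auto simp: X_def with_ends_def)
  have xU: "u0 < x j" "x j < u1" "f (x j) = 0" if "j \<in> {1..n}" for j
  proof -
    have "x j \<in> stationary_points f (einterval u0 u1)" using stat that by blast
    then show "u0 < x j" "x j < u1" "f (x j) = 0"
      by (auto simp: stationary_points_def einterval_iff)
  qed
  have x_less: "x i < x j" if "i \<in> {1..n}" "j \<in> {1..n}" "i < j" for i j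
    using strict_mono_onD[OF x] that by blast
  have x_le: "x i \<le> x j" if "i \<in> {1..n}" "j \<in> {1..n}" "i \<le> j" for i j
    using x_less[of i j] that by (cases "i = j") auto
  have xI: "X (j - 1) < x j" "x j < X (j + 1)" if j: "j \<in> {1..n}" for j
  proof -
    have "j \<noteq> 1 \<Longrightarrow> x (j - 1) < x j" "j \<noteq> n \<Longrightarrow> x j < x (j + 1)"
      using j by (auto intro!: x_less)
    then show "X (j - 1) < x j" "x j < X (j + 1)"
      unfolding X_left[OF j] X_right[OF j] using xU[OF j] by auto
  qed
  have Xle: "u0 \<le> X (j - 1)" "X (j + 1) \<le> u1" if j: "j \<in> {1..n}" for j
  proof -
    have "j \<noteq> 1 \<Longrightarrow> u0 < x (j - 1)" "j \<noteq> n \<Longrightarrow> x (j + 1) < u1"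
      using j by (auto intro!: xU)
    then show "u0 \<le> X (j - 1)" "X (j + 1) \<le> u1"
      unfolding X_left[OF j] X_right[OF j] by (auto intro: less_imp_le)
  qed
  have IU: "I j \<subseteq> einterval u0 u1" if "j \<in> {1..n}" for j
    using Xle[OF that] by (auto simp: I_def einterval_iff intro: le_less_trans less_le_trans)
  have fI: "C_on (Suc (Suc k)) f (I j)" if "j \<in> {1..n}" for j
    using C_on_subset[OF f IU[OF that]] .
  have zeros: "f s = 0 \<longleftrightarrow> s = x j" if j: "j \<in> {1..n}" and s: "s \<in> I j" for s j
  proof
    assume "f s = 0"
    then have "s \<in> x ` {1..n}"
      using s IU[OF j] unfolding stat[symmetric] stationary_points_def by blast
    then obtain i where i: "i \<in> {1..n}" "s = x i" by blast
    \<comment> \<open>A zero of smaller index is at most \<open>x (j - 1)\<close>, the excluded left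
      end of \<open>I j\<close>.\<close>
    have "\<not> i < j"
    proof
      assume "i < j"
      then have "j \<noteq> 1" "x i \<le> x (j - 1)" using i(1) j by (auto intro!: x_le)
      then show False using s i(2) X_left[OF j] by (auto simp: I_def einterval_iff)
    qed
    moreover have "\<not> j < i"
    proof
      assume "j < i"
      then have "j \<noteq> n" "x (j + 1) \<le> x i" using i(1) j by (auto intro!: x_le)
      then show False using s i(2) X_right[OF j] by (auto simp: I_def einterval_iff)
    qed
    ultimately show "s = x j" using i(2) by (metis linorder_neqE_nat)
  qed (simp add: xU(3)[OF j])
  have "\<forall>j\<in>{1..n}. \<exists>\<phi>. C_on (Suc (Suc k)) \<phi> (I j) \<and> \<phi> (x j) = 0 \<and>
      (\<forall>s\<in>I j. deriv \<phi> s > 0 \<and> deriv \<phi> s * f s = deriv f (x j) * \<phi> s)"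
  proof
    fix j assume j: "j \<in> {1..n}"
    have p: "x j \<in> I j" using xI[OF j] by (simp add: I_def einterval_iff)
    show "\<exists>\<phi>. C_on (Suc (Suc k)) \<phi> (I j) \<and> \<phi> (x j) = 0 \<and>
      (\<forall>s\<in>I j. deriv \<phi> s > 0 \<and> deriv \<phi> s * f s = deriv f (x j) * \<phi> s)"
      using linearization[OF fI[OF j, unfolded I_def] p[unfolded I_def]
          zeros[OF j, unfolded I_def] refl hyp[OF j]]
      unfolding I_def by metis
  qed
  then obtain \<Phi> where \<Phi>: "\<And>j. j \<in> {1..n} \<Longrightarrow> C_on (Suc (Suc k)) (\<Phi> j) (I j)"
      "\<And>j. j \<in> {1..n} \<Longrightarrow> \<Phi> j (x j) = 0"
      "\<And>j s. j \<in> {1..n} \<Longrightarrow> s \<in> I j \<Longrightarrow>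
        deriv (\<Phi> j) s > 0 \<and> deriv (\<Phi> j) s * f s = deriv f (x j) * \<Phi> j s"
    unfolding bchoice_iff by blast
  have xj: "x j \<in> I j" if "j \<in> {1..n}" for j
    using xI[OF that] by (simp add: I_def einterval_iff)
  have mono: "\<Phi> j s < \<Phi> j t" if j: "j \<in> {1..n}" and st: "s \<in> I j" "t \<in> I j" "s < t" for j s t
  proof (rule DERIV_pos_imp_increasing[OF st(3)])
    fix z assume "s \<le> z" "z \<le> t"
    then have "z \<in> I j" using st by (auto simp: I_def einterval_iff) (meson ereal_less_eq(3) le_less_trans less_le_trans)+
    then show "\<exists>y. (\<Phi> j has_real_derivative y) (at z) \<and> 0 < y"
      using C_on_SucD(1)[OF \<Phi>(1)[OF j]] \<Phi>(3)[OF j] by blast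
  qed
  have mono_iff: "\<Phi> j s < \<Phi> j t \<longleftrightarrow> s < t" if "j \<in> {1..n}" "s \<in> I j" "t \<in> I j" for j s t
    using mono[OF that(1), of s t] mono[OF that(1), of t s] that(2,3)
    by (metis less_asym linorder_neqE_linordered_idom less_irrefl)
  have cont: "continuous_on (I j) (\<Phi> j)" if "j \<in> {1..n}" for j
    using \<Phi>(1)[OF that] by (rule C_on_continuous)
  have fdiff: "f field_differentiable at (x j)" if "j \<in> {1..n}" for j
    using C_on_SucD(1)[OF fI[OF that] xj[OF that]] by (auto simp: field_differentiable_def)
  \<comment> \<open>For \<open>j \<noteq> n\<close> the right end of \<open>I j\<close> is the zero
    \<open>x (j + 1)\<close>, where \<open>\<Phi> j\<close> blows up.\<close>
  have above: "\<exists>s\<in>I j. M < \<Phi> j s" if j: "j \<in> {1..n}" "j \<noteq> n" for j M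
  proof -
    have j': "j + 1 \<in> {1..n}" using j by auto
    have sub: "s \<in> I j" if "x j < s" "s < x (j + 1)" for s
      using that xI(1)[OF j(1)] X_right[OF j(1)] j(2)
      by (auto simp: I_def einterval_iff intro: less_trans)
    have "\<exists>s. x j < s \<and> s < x (j + 1) \<and> M < \<Phi> j s"
    proof (rule linearization_unbounded_above[where f = f and c = "deriv f (x j)" and \<phi>' = "deriv (\<Phi> j)"])
      show "x j < x (j + 1)" using x_less[OF j(1) j'] by simp
      show "deriv f (x j) \<noteq> 0" "f (x (j + 1)) = 0" "f field_differentiable at (x (j + 1))"
        using hyp[OF j(1)] xU(3)[OF j'] fdiff[OF j'] by auto
      fix s assume s: "x j < s" "s < x (j + 1)"
      show "(\<Phi> j has_real_derivative deriv (\<Phi> j) s) (at s)"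
        using C_on_SucD(1)[OF \<Phi>(1)[OF j(1)] sub[OF s]] .
      show "\<Phi> j s > 0 \<and> deriv (\<Phi> j) s > 0"
        using mono[OF j(1) xj[OF j(1)] sub[OF s] s(1)] \<Phi>(2)[OF j(1)] \<Phi>(3)[OF j(1) sub[OF s]] by simp
      show "deriv (\<Phi> j) s * f s = deriv f (x j) * \<Phi> j s"
        using \<Phi>(3)[OF j(1) sub[OF s]] by simp
    qed
    then show ?thesis using sub by blast
  qed
  have below: "\<exists>s\<in>I j. \<Phi> j s < M" if j: "j \<in> {1..n}" "j \<noteq> 1" for j M
  proof -
    have j': "j - 1 \<in> {1..n}" using j by auto
    have sub: "s \<in> I j" if "x (j - 1) < s" "s < x j" for s
      using that xI(2)[OF j(1)] X_left[OF j(1)] j(2) less_trans[of "ereal s" "ereal (x j)"]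
      by (auto simp: I_def einterval_iff)
    have "\<exists>s. x (j - 1) < s \<and> s < x j \<and> \<Phi> j s < M"
    proof (rule linearization_unbounded_below[where f = f and c = "deriv f (x j)" and \<phi>' = "deriv (\<Phi> j)"])
      show "x (j - 1) < x j" using x_less[OF j' j(1)] j by auto
      show "deriv f (x j) \<noteq> 0" "f (x (j - 1)) = 0" "f field_differentiable at (x (j - 1))"
        using hyp[OF j(1)] xU(3)[OF j'] fdiff[OF j'] by auto
      fix s assume s: "x (j - 1) < s" "s < x j"
      show "(\<Phi> j has_real_derivative deriv (\<Phi> j) s) (at s)"
        using C_on_SucD(1)[OF \<Phi>(1)[OF j(1)] sub[OF s]] .
      show "\<Phi> j s < 0 \<and> deriv (\<Phi> j) s > 0"
        using mono[OF j(1) sub[OF s] xj[OF j(1)] s(2)] \<Phi>(2)[OF j(1)] \<Phi>(3)[OF j(1) sub[OF s]] by simp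
      show "deriv (\<Phi> j) s * f s = deriv f (x j) * \<Phi> j s"
        using \<Phi>(3)[OF j(1) sub[OF s]] by simp
    qed
    then show ?thesis using sub by blast
  qed
  have n1: "1 \<in> {1..n}" "n \<in> {1..n}" using n by auto
  \<comment> \<open>Any point of \<open>I 1\<close> left of \<open>x 1\<close> will do, and later
    any \<open>r\<close> in \<open>I n\<close> right of \<open>x n\<close>; the index
    \<open>1 - 1\<close> is the form delivered by \<open>xI\<close>.\<close>
  obtain l where "X (1 - 1) < ereal l" "l < x 1"
    using ereal_dense2[OF xI(1)[OF n1(1)]] by auto
  then have l: "l \<in> I 1" "l < x 1"
    using xI(2)[OF n1(1)] less_trans[of "ereal l" "ereal (x 1)"] by (auto simp: I_def einterval_iff)
  obtain r where "x n < r" "ereal r < X (n + 1)"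
    using ereal_dense2[OF xI(2)[OF n1(2)]] by auto
  then have r: "r \<in> I n" "x n < r"
    using xI(1)[OF n1(2)] by (auto simp: I_def einterval_iff intro: less_trans)
  \<comment> \<open>For \<open>\<epsilon> \<le> \<delta>\<close> the level
    \<open>- \<epsilon>\<close> is attained between \<open>l\<close> and \<open>x 1\<close>, and
    \<open>\<epsilon>\<close> between \<open>x n\<close> and \<open>r\<close>.\<close>
  define \<delta> where "\<delta> = min (- \<Phi> 1 l) (\<Phi> n r)"
  have "\<delta> > 0"
    using mono[OF n1(1) l(1) xj[OF n1(1)] l(2)] mono[OF n1(2) xj[OF n1(2)] r]
      \<Phi>(2)[OF n1(1)] \<Phi>(2)[OF n1(2)] by (simp add: \<delta>_def)
  moreover have "\<exists>x0\<in>{u0..<ereal (x 1)}. \<exists>xn1\<in>{ereal (x n)<..u1}. \<forall>j\<in>{1..n}.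
         C_on (Suc (Suc k)) (\<Phi> j) (basin n x0 xn1 x j) \<and>
         bij_betw (\<Phi> j) (basin n x0 xn1 x j) (normal_range n \<epsilon> j) \<and>
         (\<forall>s\<in>basin n x0 xn1 x j. deriv (\<Phi> j) s > 0 \<and> deriv (\<Phi> j) s * f s = deriv f (x j) * \<Phi> j s)"
    if \<epsilon>: "0 < \<epsilon>" "\<epsilon> \<le> \<delta>" for \<epsilon>
  proof -
    have "- \<epsilon> \<in> \<Phi> 1 ` I 1"
      unfolding I_def
      by (rule image_einterval_intermediate[of _ _ _ l "x 1"])
        (use cont[OF n1(1)] l xj[OF n1(1)] \<Phi>(2)[OF n1(1)] \<epsilon> in \<open>auto simp: I_def \<delta>_def\<close>)
    then obtain a where a: "a \<in> I 1" "\<Phi> 1 a = - \<epsilon>" by auto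
    have "\<epsilon> \<in> \<Phi> n ` I n"
      unfolding I_def
      by (rule image_einterval_intermediate[of _ _ _ "x n" r])
        (use cont[OF n1(2)] r xj[OF n1(2)] \<Phi>(2)[OF n1(2)] \<epsilon> in \<open>auto simp: I_def \<delta>_def\<close>)
    then obtain b where b: "b \<in> I n" "\<Phi> n b = \<epsilon>" by auto
    have ax: "a < x 1" and bx: "x n < b"
      using mono_iff[OF n1(1) a(1) xj[OF n1(1)]] mono_iff[OF n1(2) xj[OF n1(2)] b(1)]
        a(2) b(2) \<Phi>(2)[OF n1(1)] \<Phi>(2)[OF n1(2)] \<epsilon> by auto
    have aU: "u0 < a" and bU: "b < u1"
      using a(1) b(1) IU[OF n1(1)] IU[OF n1(2)] by (auto simp: einterval_iff)
    \<comment> \<open>As \<open>\<Phi> j\<close> is increasing, cutting at the points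
      \<open>a\<close> and \<open>b\<close> is the same as restricting its values by
      \<open>- \<epsilon>\<close> and \<open>\<epsilon>\<close>. For \<open>n = 1\<close> both cuts
      fall on the same basin.\<close>
    have B: "basin n (ereal a) (ereal b) x j = {s \<in> I j. \<Phi> j s \<in> normal_range n \<epsilon> j}"
      if j: "j \<in> {1..n}" for j
    proof -
      have Bl: "with_ends n a b x (j - 1) = (if j = 1 then ereal a else X (j - 1))"
        and Br: "with_ends n a b x (j + 1) = (if j = n then ereal b else X (j + 1))"
        using j by (auto simp: X_def with_ends_def)
      have left: "with_ends n a b x (j - 1) < ereal s \<longleftrightarrow>
          X (j - 1) < ereal s \<and> (j = 1 \<longrightarrow> - \<epsilon> < \<Phi> j s)" if s: "ereal s < X (j + 1)" for s
      proof (cases "j = 1")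
        case True
        have "X 0 < ereal a" using a(1) by (simp add: I_def einterval_iff)
        then have "a < s \<Longrightarrow> X 0 < ereal s" by (rule less_trans) simp
        moreover have "X 0 < ereal s \<Longrightarrow> a < s \<longleftrightarrow> - \<epsilon> < \<Phi> 1 s"
          using mono_iff[OF n1(1) a(1), of s] a(2) s True by (simp add: I_def einterval_iff)
        ultimately show ?thesis using True Bl by auto
      qed (use Bl in auto)
      have right: "ereal s < with_ends n a b x (j + 1) \<longleftrightarrow>
          ereal s < X (j + 1) \<and> (j = n \<longrightarrow> \<Phi> j s < \<epsilon>)" if s: "X (j - 1) < ereal s" for s
      proof (cases "j = n")
        case True
        have "ereal b < X (n + 1)" using b(1) by (simp add: I_def einterval_iff)
        then have "s < b \<Longrightarrow> ereal s < X (n + 1)" by (rule less_trans[rotated]) simp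
        moreover have "ereal s < X (n + 1) \<Longrightarrow> s < b \<longleftrightarrow> \<Phi> n s < \<epsilon>"
          using mono_iff[OF n1(2) _ b(1), of s] b(2) s True by (simp add: I_def einterval_iff)
        ultimately show ?thesis using True Br by auto
      qed (use Br in auto)
      have "X (j - 1) \<le> with_ends n a b x (j - 1)" "with_ends n a b x (j + 1) \<le> X (j + 1)"
        using a(1) b(1) Bl Br by (auto simp: I_def einterval_iff)
      then show ?thesis
        using left right unfolding I_def einterval_iff normal_range_def
        by (auto simp: einterval_iff intro: le_less_trans less_le_trans)
    qed
    have "bij_betw (\<Phi> j) (basin n a b x j) (normal_range n \<epsilon> j)" if j: "j \<in> {1..n}" for j
    proof -
      have "inj_on (\<Phi> j) (I j)"
        using mono[OF j] by (intro linorder_inj_onI) (auto simp: less_imp_neq)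
      moreover have "z \<in> \<Phi> j ` I j" if z: "z \<in> normal_range n \<epsilon> j" for z
      proof -
        \<comment> \<open>A value at most \<open>z\<close> comes from the cut point \<open>a\<close>
          at the outer end, and from unboundedness at an inner end; \<open>t\<close> is found in the
          same way.\<close>
        obtain s where s: "s \<in> I j" "\<Phi> j s \<le> z"
        proof (cases "j = 1")
          case True
          then show ?thesis using that[of a] a z by (auto simp: normal_range_def)
        next
          case False
          then show ?thesis using that below[OF j False, of z] by (auto intro: less_imp_le)
        qed
        obtain t where t: "t \<in> I j" "z \<le> \<Phi> j t"
        proof (cases "j = n")
          case True
          then show ?thesis using that[of b] b z by (auto simp: normal_range_def)
        next
          case False
          then show ?thesis using that above[OF j False, of z] by (auto intro: less_imp_le)
        qed
        show ?thesis
          using image_einterval_intermediate[OF cont[OF j, unfolded I_def]] s t unfolding I_def by blast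
      qed
      ultimately show ?thesis
        unfolding B[OF j] bij_betw_def by (auto intro: inj_on_subset)
    qed
    moreover have "basin n a b x j \<subseteq> I j" if "j \<in> {1..n}" for j
      using B[OF that] by blast
    ultimately have "\<forall>j\<in>{1..n}.
         C_on (Suc (Suc k)) (\<Phi> j) (basin n a b x j) \<and>
         bij_betw (\<Phi> j) (basin n a b x j) (normal_range n \<epsilon> j) \<and>
         (\<forall>s\<in>basin n a b x j. deriv (\<Phi> j) s > 0 \<and> deriv (\<Phi> j) s * f s = deriv f (x j) * \<Phi> j s)"
      using \<Phi>(1,3) by (meson C_on_subset subsetD)
    then show ?thesis
      using ax bx aU bU by (intro bexI[of _ "ereal a"] bexI[of _ "ereal b"]) auto
  qed
  ultimately show ?thesis using that by blast
qed

section \<open>Matching the linearizations of the two equations\<close>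

theorem theorem4:
  fixes u0 u1 v0 v1 :: ereal
    and f g :: "real \<Rightarrow> real"
    and x y :: "nat \<Rightarrow> real"
    and k n :: nat
  assumes "k \<ge> 2"
    and "C_on k f (einterval u0 u1)"
    and "C_on k g (einterval v0 v1)"
    and "n \<ge> 1"
    and "strict_mono_on {1..n} x"
    and "stationary_points f (einterval u0 u1) = x ` {1..n}"
    and "strict_mono_on {1..n} y"
    and "stationary_points g (einterval v0 v1) = y ` {1..n}"
    and "\<And>j. j \<in> {1..n} \<Longrightarrow> deriv f (x j) = deriv g (y j) \<and> deriv f (x j) \<noteq> 0"
  shows "\<exists>x0 y0 xn1 yn1 :: ereal.
           x0 \<in> {u0..<ereal (x 1)} \<and> y0 \<in> {v0..<ereal (y 1)} \<and>
           xn1 \<in> {ereal (x n)<..u1} \<and> yn1 \<in> {ereal (y n)<..v1} \<and>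
           (let X = with_ends n x0 xn1 x; Y = with_ends n y0 yn1 y in
            \<forall>j\<in>{1..n}. C_conjugate k
               (einterval (X (j - 1)) (X (j + 1))) f
               (einterval (Y (j - 1)) (Y (j + 1))) g)"
proof -
  \<comment> \<open>Two orders of differentiability are split off, one for each Hadamard
    quotient.\<close>
  obtain l where k: "k = Suc (Suc l)"
    using assms(1) by (metis Suc_le_D numeral_2_eq_2 Suc_le_mono)
  have hg: "deriv g (y j) \<noteq> 0" if "j \<in> {1..n}" for j
    using assms(9)[OF that] by simp
  obtain \<Phi> \<delta> where \<Phi>: "\<delta> > 0"
    "\<And>\<epsilon>. 0 < \<epsilon> \<Longrightarrow> \<epsilon> \<le> \<delta> \<Longrightarrow>
       \<exists>x0\<in>{u0..<ereal (x 1)}. \<exists>xn1\<in>{ereal (x n)<..u1}. \<forall>j\<in>{1..n}.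
         C_on k (\<Phi> j) (basin n x0 xn1 x j) \<and>
         bij_betw (\<Phi> j) (basin n x0 xn1 x j) (normal_range n \<epsilon> j) \<and>
         (\<forall>s\<in>basin n x0 xn1 x j. deriv (\<Phi> j) s > 0 \<and> deriv (\<Phi> j) s * f s = deriv f (x j) * \<Phi> j s)"
    using basin_linearizations[OF assms(2)[unfolded k] assms(4,5,6)] assms(9) unfolding k by metis
  obtain \<Psi> \<delta>' where \<Psi>: "\<delta>' > 0"
    "\<And>\<epsilon>. 0 < \<epsilon> \<Longrightarrow> \<epsilon> \<le> \<delta>' \<Longrightarrow>
       \<exists>y0\<in>{v0..<ereal (y 1)}. \<exists>yn1\<in>{ereal (y n)<..v1}. \<forall>j\<in>{1..n}.
         C_on k (\<Psi> j) (basin n y0 yn1 y j) \<and>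
         bij_betw (\<Psi> j) (basin n y0 yn1 y j) (normal_range n \<epsilon> j) \<and>
         (\<forall>s\<in>basin n y0 yn1 y j. deriv (\<Psi> j) s > 0 \<and> deriv (\<Psi> j) s * g s = deriv g (y j) * \<Psi> j s)"
    using basin_linearizations[OF assms(3)[unfolded k] assms(4,7,8) hg] unfolding k by metis
  \<comment> \<open>One level for both equations, so that the linearizations have the same
    ranges.\<close>
  define \<epsilon> where "\<epsilon> = min \<delta> \<delta>'"
  have \<epsilon>: "0 < \<epsilon>" "\<epsilon> \<le> \<delta>" "\<epsilon> \<le> \<delta>'" using \<Phi>(1) \<Psi>(1) by (auto simp: \<epsilon>_def)
  obtain x0 xn1 where X: "x0 \<in> {u0..<ereal (x 1)}" "xn1 \<in> {ereal (x n)<..u1}"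
    "\<And>j. j \<in> {1..n} \<Longrightarrow> C_on k (\<Phi> j) (basin n x0 xn1 x j) \<and>
         bij_betw (\<Phi> j) (basin n x0 xn1 x j) (normal_range n \<epsilon> j) \<and>
         (\<forall>s\<in>basin n x0 xn1 x j. deriv (\<Phi> j) s > 0 \<and> deriv (\<Phi> j) s * f s = deriv f (x j) * \<Phi> j s)"
    using \<Phi>(2)[OF \<epsilon>(1,2)] by blast
  obtain y0 yn1 where Y: "y0 \<in> {v0..<ereal (y 1)}" "yn1 \<in> {ereal (y n)<..v1}"
    "\<And>j. j \<in> {1..n} \<Longrightarrow> C_on k (\<Psi> j) (basin n y0 yn1 y j) \<and>
         bij_betw (\<Psi> j) (basin n y0 yn1 y j) (normal_range n \<epsilon> j) \<and>
         (\<forall>s\<in>basin n y0 yn1 y j. deriv (\<Psi> j) s > 0 \<and> deriv (\<Psi> j) s * g s = deriv g (y j) * \<Psi> j s)"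
    using \<Psi>(2)[OF \<epsilon>(1,3)] by blast
  \<comment> \<open>The equality of \<open>deriv f (x j)\<close> and \<open>deriv g (y j)\<close>
    supplies the common constant \<open>c\<close>.\<close>
  have "C_conjugate k (basin n x0 xn1 x j) f (basin n y0 yn1 y j) g" if j: "j \<in> {1..n}" for j
    unfolding k
    by (rule C_conjugate_if_linearizations[where c = "deriv f (x j)" and \<phi> = "\<Phi> j" and \<psi> = "\<Psi> j"
          and W = "normal_range n \<epsilon> j"])
      (use X(3)[OF j] Y(3)[OF j] assms(9)[OF j] in \<open>auto simp: k\<close>)
  then show ?thesis
    using X(1,2) Y(1,2) unfolding Let_def by blast
qed

end
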